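(* Assume (A1), (A2) (see context), $\sigma>0$, $0<v_{\max}<+\infty$, and $\theta(s)>0$ for all $s>0$. For each $x^*>0$ let $(V(\cdot,x^* ),p(\cdot,x^* ))$ be a solution on $[0,x^*]$ of the boundary value problem (BVP) in the context. Then: (i) if $\liminf_{s\to+\infty}\theta(s)s=+\infty$, then $$\lim_{x^*\to\infty}V(x,x^* )=0\qquad\text{for all }x\in[0,\infty[;$$ (ii) if $\limsup_{s\to+\infty}\theta(s)s=C_1<+\infty$, then $$\liminf_{x^*\to\infty}V(x,x^* )\ge\frac{rB}{2(2r+v_{\max}-\mu)}$$ for all $x\ge\dfrac{2\big(r+v_{\max}+(1+C_1(r+v_{\max}))(r-\mu)\big)}{r(r-\mu)}$.
   Context: Notation: $]a,b[$ denotes an open interval. Constants: $r$ (discount rate), $\mu$ (growth rate), $\lambda$ (repayment rate), $\sigma$ (volatility), $B>0$ (bankruptcy cost). $\theta:\,]0,+\infty[\to[0,1]$ is the salvage rate as a function of the bankruptcy threshold. Standing assumptions: $r>\mu$, $\lambda,\mu\ge0$, $\lambda+\mu>0$. Cost functions: there exist $\delta_0>0$ and $v_{\max}\in\,]0,+\infty]$ such that (A1) $L:[0,1[\to\mathbb R$ is continuous on $[0,1[$, twice continuously differentiable on $]0,1[$, with $L(0)=0$, $L'(u)>0$ and $L''(u)>\delta_0$ for $u\in]0,1[$, and $\lim_{u\to1^-}L(u)=+\infty$. (A2) $c:[0,v_{\max}[\to\mathbb R$ is continuous on $[0,v_{\max}[$, twice continuously differentiable on $]0,v_{\max}[$, with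 $c(0)=0$, $c'(v)>0$ and $c''(v)>\delta_0$ for $v\in]0,v_{\max}[$, and $\lim_{v\to v_{\max}^-}c(v)=+\infty$. $L$ and $c$ are extended to $\mathbb R$ by $+\infty$ outside $[0,1[$ and $[0,v_{\max}[$. For a function $F$ on $\mathbb R$, $F^\circ(\rho)=\sup_{z\in\mathbb R}\{\rho z-F(z)\}$ is its convex conjugate. The Hamiltonian is $$H(x,\xi,p)=-L^\circ\left(\frac{\xi}{p}\right)-c^\circ(x\xi)+\left(\frac{\lambda+r}{p}-\lambda-\mu+\sigma^2\right)x\,\xi ,$$ and $H_\xi$ is its partial derivative in $\xi$. (BVP) for threshold $x^*$: functions $V(\cdot)=V(\cdot,x^* ):[0,x^*]\to\mathbb R$, $p(\cdot)=p(\cdot,x^* ):[0,x^*]\to\,]0,1]$ of class $C^2$ with $$\begin{cases} rV(x)=H(x,V'(x),p(x))+\dfrac{\sigma^2x^2}{2}V''(x),\\[2mm] (r+\lambda+v(x))p(x)-(r+\lambda)=H_\xi(x,V'(x),p(x))\,p'(x)+\dfrac{\sigma^2x^2}{2}p''(x),\\[2mm] v(x)=\operatorname{argmin}_{w\ge 0}\{c(w)-w\,xV'(x)\},\end{cases}$$ and $V(0)=0$, $V(x^* )=B$, $p(0)=1$, $p(x^* )=\theta(x^* )$. *)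

theory Defs
  imports "HOL-Analysis.Analysis"
begin

text \<open>
  The standing assumption (A1) for \<open>L\<close> is \<open>cost_function \<delta> 1 L\<close>, and (A2) for \<open>c\<close> is
  \<open>cost_function \<delta> vmax c\<close>, with a common \<open>\<delta> > 0\<close>. The values of \<open>F\<close> outside \<open>[0, b[\<close> are
  irrelevant: \<open>infinity_ext\<close> overrides them.
\<close>

definition cost_function :: "real \<Rightarrow> real \<Rightarrow> (real \<Rightarrow> real) \<Rightarrow> bool" where
  "cost_function \<delta> b F \<longleftrightarrow>
     continuous_on {0..<b} F \<and> F 0 = 0 \<and>
     (\<exists>F' F''. (\<forall>u\<in>{0<..<b}. (F has_real_derivative F' u) (at u) \<and>
                              (F' has_real_derivative F'' u) (at u) \<and>
                              F' u > 0 \<and> F'' u > \<delta>) \<and>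
               continuous_on {0<..<b} F'') \<and>
     filterlim F at_top (at_left b)"

definition infinity_ext :: "real \<Rightarrow> (real \<Rightarrow> real) \<Rightarrow> real \<Rightarrow> ereal" where
  "infinity_ext b F z = (if z \<in> {0..<b} then ereal (F z) else \<infinity>)"

definition convex_conjugate :: "(real \<Rightarrow> ereal) \<Rightarrow> real \<Rightarrow> ereal" where
  "convex_conjugate F \<rho> = (SUP z. ereal (\<rho> * z) - F z)"

text \<open>
  For cost functions on bounded intervals both conjugates are finite everywhere, so nothing is
  lost by \<open>real_of_ereal\<close>.
\<close>

definition hamiltonian ::
  "(real \<Rightarrow> real) \<Rightarrow> (real \<Rightarrow> real) \<Rightarrow> real \<Rightarrow> real \<Rightarrow> real \<Rightarrow> real \<Rightarrow> real
     \<Rightarrow> real \<Rightarrow> real \<Rightarrow> real \<Rightarrow> real" where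
  "hamiltonian L c vmax r \<mu> lam \<sigma> x \<xi> p =
     - real_of_ereal (convex_conjugate (infinity_ext 1 L) (\<xi> / p))
     - real_of_ereal (convex_conjugate (infinity_ext vmax c) (x * \<xi>))
     + ((lam + r) / p - lam - \<mu> + \<sigma>\<^sup>2) * x * \<xi>"

definition hamiltonian_\<xi> ::
  "(real \<Rightarrow> real) \<Rightarrow> (real \<Rightarrow> real) \<Rightarrow> real \<Rightarrow> real \<Rightarrow> real \<Rightarrow> real \<Rightarrow> real
     \<Rightarrow> real \<Rightarrow> real \<Rightarrow> real \<Rightarrow> real" where
  "hamiltonian_\<xi> L c vmax r \<mu> lam \<sigma> x \<xi> p =
     deriv (\<lambda>\<eta>. hamiltonian L c vmax r \<mu> lam \<sigma> x \<eta> p) \<xi>"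

text \<open>
  \<open>f\<close> is of class \<open>C\<^sup>2\<close> on \<open>S\<close> with derivatives \<open>f'\<close> and \<open>f''\<close>; on a closed interval the derivatives
  at the endpoints are one-sided.
\<close>

definition C2_on :: "real set \<Rightarrow> (real \<Rightarrow> real) \<Rightarrow> (real \<Rightarrow> real) \<Rightarrow> (real \<Rightarrow> real) \<Rightarrow> bool" where
  "C2_on S f f' f'' \<longleftrightarrow>
     (\<forall>x\<in>S. (f has_real_derivative f' x) (at x within S) \<and>
            (f' has_real_derivative f'' x) (at x within S)) \<and>
     continuous_on S f''"

definition BVP_solution ::
  "(real \<Rightarrow> real) \<Rightarrow> (real \<Rightarrow> real) \<Rightarrow> real \<Rightarrow> real \<Rightarrow> real \<Rightarrow> real \<Rightarrow> real \<Rightarrow> real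
     \<Rightarrow> (real \<Rightarrow> real) \<Rightarrow> real \<Rightarrow> (real \<Rightarrow> real) \<Rightarrow> (real \<Rightarrow> real) \<Rightarrow> bool" where
  "BVP_solution L c vmax r \<mu> lam \<sigma> B \<theta> xs V p \<longleftrightarrow>
     (\<forall>x\<in>{0..xs}. 0 < p x \<and> p x \<le> 1) \<and>
     (\<exists>V' V'' p' p'' v.
        C2_on {0..xs} V V' V'' \<and> C2_on {0..xs} p p' p'' \<and>
        (\<forall>x\<in>{0..xs}.
           r * V x = hamiltonian L c vmax r \<mu> lam \<sigma> x (V' x) (p x)
                     + \<sigma>\<^sup>2 * x\<^sup>2 / 2 * V'' x \<and>
           (r + lam + v x) * p x - (r + lam)
             = hamiltonian_\<xi> L c vmax r \<mu> lam \<sigma> x (V' x) (p x) * p' x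
               + \<sigma>\<^sup>2 * x\<^sup>2 / 2 * p'' x \<and>
           is_arg_min (\<lambda>w. infinity_ext vmax c w - ereal (w * x * V' x)) (\<lambda>w. 0 \<le> w) (v x))) \<and>
     V 0 = 0 \<and> V xs = B \<and> p 0 = 1 \<and> p xs = \<theta> xs"

end

theory Submission
  imports Defs
begin

text \<open>
  The debt drifts upwards at a rate of order \<open>x/p\<close>, so the discounted cost of
  bankruptcy seen from a fixed \<open>x\<close> is governed by how fast \<open>p\<close> decays. With \<open>C = \<theta>(x\<^sup>*) x\<^sup>*\<close>,
  comparison with explicit barriers gives \<open>p \<ge> \<kappa> C / (x + C)\<close> and
  \<open>p \<le> max {1 / (r - \<mu>), C} / x\<close>. In the first case the drift is at most linear up to debts of size
  \<open>C\<close>, and \<open>V \<le> B (2 x / (x + C))\<^sup>\<gamma>\<close>, which vanishes as \<open>C \<rightarrow> \<infinity>\<close>. In the second the drift is quadratic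
  when \<open>C\<close> stays bounded, the debt explodes in a time independent of \<open>x\<^sup>*\<close>, and
  \<open>V \<ge> B (1 - a / x)\<close> with \<open>a\<close> half of the threshold in (ii). This yields the bound \<open>B / 2\<close>.
\<close>

section \<open>A maximum principle\<close>

text \<open>A negative minimum is interior by the boundary values, hence critical, and a negative
  second derivative there makes \<open>f\<close> decrease strictly to its right. The sign condition
  is asked only where \<open>f x < 0\<close> and \<open>f' x = 0\<close>, so each barrier below is
  tested at a contact point where the slope is known.\<close>

lemma nonneg_of_no_negative_min:
  fixes f f' f'' :: "real \<Rightarrow> real"
  assumes cont: "continuous_on {a..b} f"
    and f': "\<And>x. a < x \<Longrightarrow> x < b \<Longrightarrow> (f has_real_derivative f' x) (at x)"
    and f'': "\<And>x. a < x \<Longrightarrow> x < b \<Longrightarrow> (f' has_real_derivative f'' x) (at x)"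
    and bdry: "0 \<le> f a" "0 \<le> f b"
    and concave: "\<And>x. a < x \<Longrightarrow> x < b \<Longrightarrow> f x < 0 \<Longrightarrow> f' x = 0 \<Longrightarrow> f'' x < 0"
    and x: "a \<le> x" "x \<le> b"
  shows "0 \<le> f x"
proof (rule ccontr)
  assume neg: "\<not> 0 \<le> f x"
  obtain m where m: "m \<in> {a..b}" and min: "\<And>y. y \<in> {a..b} \<Longrightarrow> f m \<le> f y"
    using continuous_attains_inf[OF compact_Icc _ cont] x by (metis atLeastAtMost_iff empty_iff)
  have fm: "f m < 0"
    using min[of x] neg x by auto
  then have mab: "a < m" "m < b"
    using m bdry by (auto simp: less_le)
  have f'm: "f' m = 0"
  proof (rule DERIV_local_min[OF f'[OF mab]])
    show "0 < Min {m - a, b - m}"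
      using mab by simp
    show "\<forall>y. \<bar>m - y\<bar> < Min {m - a, b - m} \<longrightarrow> f m \<le> f y"
      by (auto intro!: min)
  qed
  \<comment> \<open>\<open>f'\<close> vanishes at \<open>m\<close> with negative slope, so it is
    negative just to the right of \<open>m\<close>; the mean value theorem on
    \<open>{m..m + e}\<close> then contradicts minimality.\<close>
  obtain d where d: "d > 0" "\<And>h. h > 0 \<Longrightarrow> h < d \<Longrightarrow> f' (m + h) < 0"
    using DERIV_neg_dec_right[OF f''[OF mab] concave[OF mab fm f'm]] f'm by auto
  define e where "e = min d (b - m) / 2"
  have e: "0 < e" "e < d" "m + e < b"
    using d(1) mab by (auto simp: e_def min_def field_simps)
  obtain z where z: "m < z" "z < m + e" "f (m + e) - f m = (m + e - m) * f' z"
    using MVT2[of m "m + e" f f'] f' e mab by auto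
  have "f' z < 0"
    using d(2)[of "z - m"] z e by auto
  then have "f (m + e) - f m < 0"
    unfolding z(3) using e by (simp add: mult_pos_neg)
  then show False
    using min[of "m + e"] e mab by auto
qed

section \<open>Conjugates of cost functions\<close>

lemma cost_functionE:
  assumes "cost_function \<delta> b F"
  obtains F' F'' where "continuous_on {0..<b} F" "F 0 = 0"
    "\<And>u. 0 < u \<Longrightarrow> u < b \<Longrightarrow> (F has_real_derivative F' u) (at u)"
    "\<And>u. 0 < u \<Longrightarrow> u < b \<Longrightarrow> (F' has_real_derivative F'' u) (at u)"
    "\<And>u. 0 < u \<Longrightarrow> u < b \<Longrightarrow> F' u > 0"
    "\<And>u. 0 < u \<Longrightarrow> u < b \<Longrightarrow> F'' u > \<delta>"
    "filterlim F at_top (at_left b)"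
  using assms unfolding cost_function_def by force

lemma cost_function_nonneg:
  assumes F: "cost_function \<delta> b F" and y: "0 \<le> y" "y < b"
  shows "0 \<le> F y"
proof (cases "y = 0")
  case False
  obtain F' F'' where c: "continuous_on {0..<b} F" and F0: "F 0 = 0"
    and d: "\<And>u. 0 < u \<Longrightarrow> u < b \<Longrightarrow> (F has_real_derivative F' u) (at u)"
    and pos: "\<And>u. 0 < u \<Longrightarrow> u < b \<Longrightarrow> F' u > 0"
    using F by (rule cost_functionE) blast
  have "F 0 < F y"
  proof (rule DERIV_pos_imp_increasing_open[where f = F and a = 0 and b = y])
    show "continuous_on {0..y} F"
      using c by (rule continuous_on_subset) (use y in auto)
    show "\<exists>l. DERIV F x :> l \<and> 0 < l" if "0 < x" "x < y" for x
      using d[of x] pos[of x] that y by auto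
  qed (use y False in auto)
  then show ?thesis
    using F0 by simp
next
  case True
  then show ?thesis using F by (simp add: cost_function_def)
qed

text \<open>Chord plus the parabola with second derivative \<open>\<delta>\<close> and zeros
  \<open>y\<close>, \<open>z\<close>, minus \<open>F\<close>, vanishes at both ends and has second
  derivative \<open>\<delta> - F'' < 0\<close>, so it is nonnegative. At the midpoint the parabola
  equals \<open>- \<delta> / 8 * (y - z)\<^sup>2\<close>. The maximum principle also covers the end
  0, where \<open>F\<close> is only continuous.\<close>

lemma cost_function_midpoint:
  assumes F: "cost_function \<delta> b F" and y: "0 \<le> y" "y < b" and z: "0 \<le> z" "z < b"
  shows "F ((y + z) / 2) \<le> (F y + F z) / 2 - \<delta> / 8 * (y - z)\<^sup>2"
  using y z
proof (induction y z rule: linorder_wlog)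
  case (sym y z)
  then show ?case by (simp add: add.commute power2_commute)
next
  case (le y z)
  show ?case
  proof (cases "y = z")
    case True
    then show ?thesis by simp
  next
    case False
    then have yz: "y < z" using le by simp
    obtain F' F'' where c: "continuous_on {0..<b} F"
      and d: "\<And>u. 0 < u \<Longrightarrow> u < b \<Longrightarrow> (F has_real_derivative F' u) (at u)"
      and d2: "\<And>u. 0 < u \<Longrightarrow> u < b \<Longrightarrow> (F' has_real_derivative F'' u) (at u)"
      and big: "\<And>u. 0 < u \<Longrightarrow> u < b \<Longrightarrow> F'' u > \<delta>"
      using F by (rule cost_functionE) blast
    define k where "k = (F z - F y) / (z - y)"
    have kz: "k * (z - y) = F z - F y"
      using yz by (simp add: k_def)
    define m where "m = (y + z) / 2"
    have "0 \<le> F y + k * (m - y) + \<delta> / 2 * ((m - y) * (m - z)) - F m"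
    proof (rule nonneg_of_no_negative_min[where f = "\<lambda>s. F y + k * (s - y) + \<delta> / 2 * ((s - y) * (s - z)) - F s" and x = m and a = y and b = z])
      show "continuous_on {y..z} (\<lambda>s. F y + k * (s - y) + \<delta> / 2 * ((s - y) * (s - z)) - F s)"
        using le by (intro continuous_intros continuous_on_subset[OF c]) auto
      show "((\<lambda>s. F y + k * (s - y) + \<delta> / 2 * ((s - y) * (s - z)) - F s)
          has_real_derivative k + \<delta> / 2 * (2 * s - y - z) - F' s) (at s)" if "y < s" "s < z" for s
        using that le by (auto intro!: derivative_eq_intros d simp: algebra_simps)
      show "((\<lambda>s. k + \<delta> / 2 * (2 * s - y - z) - F' s)
          has_real_derivative \<delta> - F'' s) (at s)" if "y < s" "s < z" for s
        using that le by (auto intro!: derivative_eq_intros d2)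
      show "\<delta> - F'' s < 0" if "y < s" "s < z" for s
        using that le big[of s] by auto
      show "0 \<le> F y + k * (z - y) + \<delta> / 2 * ((z - y) * (z - z)) - F z"
        using kz by simp
    qed (use yz in \<open>auto simp: m_def\<close>)
    moreover have "k * (m - y) = (F z - F y) / 2"
      using kz by (simp add: m_def field_simps)
    moreover have "\<delta> / 2 * ((m - y) * (m - z)) = - (\<delta> / 8 * (y - z)\<^sup>2)"
      by (simp add: m_def field_simps power2_eq_square)
    ultimately have "F m \<le> (F y + F z) / 2 - \<delta> / 8 * (y - z)\<^sup>2"
      by argo
    then show ?thesis
      by (simp add: m_def)
  qed
qed

text \<open>Since \<open>F\<close> blows up at \<open>b\<close>, beyond some \<open>e < b\<close>
  the objective is at most 0, its value at \<open>y = 0\<close>; the maximum over the compact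
  interval \<open>{0..e}\<close> is therefore global.\<close>

lemma cost_function_maximizer:
  assumes F: "cost_function \<delta> b F" and b: "b > 0"
  obtains z where "z \<in> {0..<b}" "\<And>y. y \<in> {0..<b} \<Longrightarrow> \<rho> * y - F y \<le> \<rho> * z - F z"
proof -
  have c: "continuous_on {0..<b} F" and F0: "F 0 = 0" and lim: "filterlim F at_top (at_left b)"
    using F by (auto simp: cost_function_def)
  have "\<forall>\<^sub>F y in at_left b. \<bar>\<rho>\<bar> * b \<le> F y"
    using lim by (simp add: filterlim_at_top)
  then obtain d where d: "d < b" "\<And>y. d < y \<Longrightarrow> y < b \<Longrightarrow> \<bar>\<rho>\<bar> * b \<le> F y"
    unfolding eventually_at_left_field by blast
  \<comment> \<open>The truncation at 0 keeps the competitor \<open>y = 0\<close> inside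
    \<open>{0..e}\<close>.\<close>
  define e where "e = max d 0"
  have e: "0 \<le> e" "e < b" using d b by (auto simp: e_def)
  have "continuous_on {0..e} F"
    by (rule continuous_on_subset[OF c]) (use e in auto)
  then have "continuous_on {0..e} (\<lambda>y. \<rho> * y - F y)"
    by (intro continuous_intros)
  from continuous_attains_sup[OF compact_Icc _ this] e
  obtain z where z: "z \<in> {0..e}" and max: "\<And>y. y \<in> {0..e} \<Longrightarrow> \<rho> * y - F y \<le> \<rho> * z - F z"
    by (metis atLeastAtMost_iff empty_iff order_refl)
  show thesis
  proof
    show "z \<in> {0..<b}" using z e by auto
    show "\<rho> * y - F y \<le> \<rho> * z - F z" if y: "y \<in> {0..<b}" for y
    proof (cases "y \<le> e")
      case True
      then show ?thesis using max y by auto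
    next
      case False
      have "\<rho> * y \<le> \<bar>\<rho>\<bar> * b"
        using y by (intro mult_mono) auto
      also have "\<dots> \<le> F y"
        using d(2)[of y] False y by (auto simp: e_def)
      finally show ?thesis
        using max[of 0] e F0 by auto
    qed
  qed
qed

text \<open>Outside \<open>{0..<b}\<close> the terms of the supremum are minus infinity, so a
  maximizer on that interval attains the extended-real conjugate, which is thus finite.\<close>

lemma real_conjugate_eq:
  assumes z: "z \<in> {0..<b}" and max: "\<And>y. y \<in> {0..<b} \<Longrightarrow> \<rho> * y - F y \<le> \<rho> * z - F z"
  shows "real_of_ereal (convex_conjugate (infinity_ext b F) \<rho>) = \<rho> * z - F z"
proof -
  have "convex_conjugate (infinity_ext b F) \<rho> = ereal (\<rho> * z - F z)"
    unfolding convex_conjugate_def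
  proof (rule SUP_eqI)
    show "ereal (\<rho> * y) - infinity_ext b F y \<le> ereal (\<rho> * z - F z)" for y
      using max[of y] by (auto simp: infinity_ext_def)
    show "ereal (\<rho> * z - F z) \<le> w"
      if "\<And>y. y \<in> UNIV \<Longrightarrow> ereal (\<rho> * y) - infinity_ext b F y \<le> w" for w
      using that[of z] z by (auto simp: infinity_ext_def)
  qed
  then show ?thesis by simp
qed

text \<open>The competitor 0 gives the lower bound; \<open>F \<ge> 0\<close> and
  \<open>z < b\<close> give the upper one.\<close>

lemma real_conjugate_bounds:
  assumes F: "cost_function \<delta> b F" and b: "b > 0"
  shows "0 \<le> real_of_ereal (convex_conjugate (infinity_ext b F) \<rho>)"
    and "0 \<le> \<rho> \<Longrightarrow> real_of_ereal (convex_conjugate (infinity_ext b F) \<rho>) \<le> b * \<rho>"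
proof -
  obtain z where z: "z \<in> {0..<b}" and max: "\<And>y. y \<in> {0..<b} \<Longrightarrow> \<rho> * y - F y \<le> \<rho> * z - F z"
    using cost_function_maximizer[OF F b] by blast
  have eq: "real_of_ereal (convex_conjugate (infinity_ext b F) \<rho>) = \<rho> * z - F z"
    by (rule real_conjugate_eq[OF z max])
  show "0 \<le> real_of_ereal (convex_conjugate (infinity_ext b F) \<rho>)"
    unfolding eq using max[of 0] b F by (simp add: cost_function_def)
  assume "0 \<le> \<rho>"
  then have "\<rho> * z \<le> \<rho> * b"
    using z by (intro mult_left_mono) auto
  then show "real_of_ereal (convex_conjugate (infinity_ext b F) \<rho>) \<le> b * \<rho>"
    unfolding eq using cost_function_nonneg[OF F, of z] z by (simp add: mult.commute)
qed

text \<open>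
  Strong convexity gives the quadratic bound
  \<open>\<bar>F\<^sup>\<circ>(\<eta>) - F\<^sup>\<circ>(\<rho>) - (\<eta> - \<rho>) z\<bar> \<le> (\<eta> - \<rho>)\<^sup>2 / \<delta>\<close>.
\<close>

lemma real_conjugate_has_derivative:
  assumes F: "cost_function \<delta> b F" and b: "b > 0" and \<delta>: "\<delta> > 0"
    and z: "z \<in> {0..<b}" and max: "\<And>y. y \<in> {0..<b} \<Longrightarrow> \<rho> * y - F y \<le> \<rho> * z - F z"
  shows "((\<lambda>\<eta>. real_of_ereal (convex_conjugate (infinity_ext b F) \<eta>)) has_real_derivative z) (at \<rho>)"
proof -
  define G where "G = (\<lambda>\<eta>. real_of_ereal (convex_conjugate (infinity_ext b F) \<eta>))"
  have G\<rho>: "G \<rho> = \<rho> * z - F z"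
    unfolding G_def by (rule real_conjugate_eq[OF z max])
  \<comment> \<open>Quadratic growth away from the maximizer: maximality of \<open>z\<close> is
    tested at the midpoint of \<open>y\<close> and \<open>z\<close> and combined with strong
    midpoint convexity.\<close>
  have growth: "F y \<ge> F z + \<rho> * (y - z) + \<delta> / 4 * (y - z)\<^sup>2" if y: "y \<in> {0..<b}" for y
  proof -
    have "\<rho> * ((y + z) / 2) - F ((y + z) / 2) \<le> \<rho> * z - F z"
      using y z by (intro max) auto
    moreover have "F ((y + z) / 2) \<le> (F y + F z) / 2 - \<delta> / 8 * (y - z)\<^sup>2"
      using y z by (intro cost_function_midpoint[OF F]) auto
    ultimately show ?thesis by (simp add: field_simps)
  qed
  have bound: "\<bar>G (\<rho> + h) - G \<rho> - h * z\<bar> \<le> h\<^sup>2 / \<delta>" for h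
  proof -
    obtain y where y: "y \<in> {0..<b}"
      and ymax: "\<And>w. w \<in> {0..<b} \<Longrightarrow> (\<rho> + h) * w - F w \<le> (\<rho> + h) * y - F y"
      using cost_function_maximizer[OF F b] by blast
    have Gh: "G (\<rho> + h) = (\<rho> + h) * y - F y"
      unfolding G_def by (rule real_conjugate_eq[OF y ymax])
    \<comment> \<open>From below, \<open>z\<close> is a competitor at the slope
      \<open>\<rho> + h\<close>; from above, \<open>growth\<close> is applied to the new maximizer
      \<open>y\<close>.\<close>
    have "G (\<rho> + h) - G \<rho> - h * z \<ge> 0"
      unfolding Gh G\<rho> using ymax[OF z] by (simp add: algebra_simps)
    moreover have "G (\<rho> + h) - G \<rho> - h * z \<le> h * (y - z) - \<delta> / 4 * (y - z)\<^sup>2"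
      unfolding Gh G\<rho> using growth[OF y] by (simp add: algebra_simps)
    \<comment> \<open>Completing the square: \<open>h * d - \<delta> / 4 * d\<^sup>2\<close> is at
      most \<open>h\<^sup>2 / \<delta>\<close> whatever the displacement
      \<open>d = y - z\<close>.\<close>
    moreover have "h\<^sup>2 / \<delta> - (h * (y - z) - \<delta> / 4 * (y - z)\<^sup>2) = (h - \<delta> / 2 * (y - z))\<^sup>2 / \<delta>"
      using \<delta> by (simp add: field_simps power2_eq_square)
    moreover have "(h - \<delta> / 2 * (y - z))\<^sup>2 / \<delta> \<ge> 0"
      using \<delta> by simp
    moreover have "0 \<le> h\<^sup>2 / \<delta>"
      using \<delta> by simp
    ultimately show ?thesis by linarith
  qed
  have "((\<lambda>h. (G (\<rho> + h) - G \<rho>) / h - z) \<longlongrightarrow> 0) (at 0)"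
  proof (rule Lim_null_comparison)
    show "\<forall>\<^sub>F h in at 0. norm ((G (\<rho> + h) - G \<rho>) / h - z) \<le> \<bar>h\<bar> / \<delta>"
    proof (rule eventually_at_filter[THEN iffD2], rule always_eventually, intro allI impI)
      fix h :: real assume h: "h \<noteq> 0"
      have "(G (\<rho> + h) - G \<rho>) / h - z = (G (\<rho> + h) - G \<rho> - h * z) / h"
        using h by (simp add: field_simps)
      then have "norm ((G (\<rho> + h) - G \<rho>) / h - z) = \<bar>G (\<rho> + h) - G \<rho> - h * z\<bar> / \<bar>h\<bar>"
        by (simp add: abs_divide)
      also have "\<dots> \<le> (h\<^sup>2 / \<delta>) / \<bar>h\<bar>"
        by (intro divide_right_mono bound) auto
      also have "\<dots> = \<bar>h\<bar> / \<delta>"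
        using h by (simp add: power2_eq_square abs_if)
      finally show "norm ((G (\<rho> + h) - G \<rho>) / h - z) \<le> \<bar>h\<bar> / \<delta>" .
    qed
    show "((\<lambda>h. \<bar>h\<bar> / \<delta>) \<longlongrightarrow> 0) (at 0)"
      using \<delta> by (auto intro!: tendsto_eq_intros)
  qed
  then show ?thesis
    unfolding G_def[symmetric] DERIV_def by (simp add: LIM_zero_iff)
qed

section \<open>Estimates for a solution\<close>

text \<open>
  The boundary value problem with the conjugates \<open>l = L\<^sup>\<circ>(V'/p)\<close>, \<open>k = c\<^sup>\<circ>(xV')\<close> and their
  derivatives \<open>u\<close>, \<open>v\<close> replaced by the bounds they satisfy; \<open>v\<close> is the same function in both
  places of the second equation.
\<close>

locale debt_equilibrium =
  fixes r \<mu> lam \<sigma> vmax xs :: real and V V' V'' p p' p'' l k u v :: "real \<Rightarrow> real"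
  assumes params: "r > \<mu>" "lam \<ge> 0" "\<mu> \<ge> 0" "\<sigma> > 0" "vmax > 0" "xs > 0"
    and V_cont: "continuous_on {0..xs} V" and p_cont: "continuous_on {0..xs} p"
    and p_pos: "\<And>x. 0 \<le> x \<Longrightarrow> x \<le> xs \<Longrightarrow> 0 < p x"
    and p_le: "\<And>x. 0 \<le> x \<Longrightarrow> x \<le> xs \<Longrightarrow> p x \<le> 1"
    and V0: "V 0 = 0" and V_end: "V xs > 0" and p0: "p 0 = 1"
    and V_deriv: "\<And>x. 0 < x \<Longrightarrow> x < xs \<Longrightarrow> (V has_real_derivative V' x) (at x)"
    and V'_deriv: "\<And>x. 0 < x \<Longrightarrow> x < xs \<Longrightarrow> (V' has_real_derivative V'' x) (at x)"
    and p_deriv: "\<And>x. 0 < x \<Longrightarrow> x < xs \<Longrightarrow> (p has_real_derivative p' x) (at x)"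
    and p'_deriv: "\<And>x. 0 < x \<Longrightarrow> x < xs \<Longrightarrow> (p' has_real_derivative p'' x) (at x)"
    and V_eq: "\<And>x. 0 < x \<Longrightarrow> x < xs \<Longrightarrow>
      r * V x = - l x - k x + ((lam + r) / p x - lam - \<mu> + \<sigma>\<^sup>2) * x * V' x + \<sigma>\<^sup>2 * x\<^sup>2 / 2 * V'' x"
    and p_eq: "\<And>x. 0 < x \<Longrightarrow> x < xs \<Longrightarrow>
      (r + lam + v x) * p x - (r + lam)
        = (((lam + r) / p x - lam - \<mu> + \<sigma>\<^sup>2) * x - u x / p x - x * v x) * p' x
          + \<sigma>\<^sup>2 * x\<^sup>2 / 2 * p'' x"
    and l_nonneg: "\<And>x. 0 < x \<Longrightarrow> x < xs \<Longrightarrow> 0 \<le> l x"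
    and k_nonneg: "\<And>x. 0 < x \<Longrightarrow> x < xs \<Longrightarrow> 0 \<le> k x"
    and l_le: "\<And>x. 0 < x \<Longrightarrow> x < xs \<Longrightarrow> 0 \<le> V' x \<Longrightarrow> l x \<le> V' x / p x"
    and k_le: "\<And>x. 0 < x \<Longrightarrow> x < xs \<Longrightarrow> 0 \<le> V' x \<Longrightarrow> k x \<le> vmax * (x * V' x)"
    and u_bounds: "\<And>x. 0 < x \<Longrightarrow> x < xs \<Longrightarrow> u x \<in> {0..1}"
    and v_bounds: "\<And>x. 0 < x \<Longrightarrow> x < xs \<Longrightarrow> v x \<in> {0..vmax}"
begin

lemma r_pos: "r > 0"
  using params by simp

text \<open>At a negative interior minimum \<open>V'\<close> vanishes, which squeezes
  \<open>l\<close> and \<open>k\<close> to 0, and the value equation reduces to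
  \<open>\<sigma>\<^sup>2 * x\<^sup>2 / 2 * V'' x = r * V x < 0\<close>.\<close>

lemma V_nonneg:
  assumes "0 \<le> x" "x \<le> xs"
  shows "0 \<le> V x"
proof (rule nonneg_of_no_negative_min[OF V_cont V_deriv V'_deriv])
  fix x assume x: "0 < x" "x < xs" and V: "V x < 0" and V': "V' x = 0"
  have "\<sigma>\<^sup>2 * x\<^sup>2 / 2 * V'' x = r * V x"
    using V_eq[OF x] l_le[OF x] k_le[OF x] l_nonneg[OF x] k_nonneg[OF x] V' by simp
  also have "\<dots> < 0"
    using V r_pos by (simp add: mult_pos_neg)
  finally show "V'' x < 0"
    using x by (auto simp: mult_less_0_iff)
qed (use assms V0 V_end in auto)

text \<open>
  On the curves \<open>p = w/x\<close> all terms of the price equation cancel except \<open>(w (r - \<mu>) - u)/x\<close>.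
\<close>

lemma price_upper:
  assumes C: "1 / (r - \<mu>) \<le> C" "xs * p xs \<le> C" and x: "0 \<le> x" "x \<le> xs"
  shows "x * p x \<le> C"
proof -
  have "0 \<le> C - x * p x"
  proof (rule nonneg_of_no_negative_min[where f = "\<lambda>x. C - x * p x" and x = x and a = 0 and b = xs])
    show "continuous_on {0..xs} (\<lambda>x. C - x * p x)"
      by (intro continuous_intros p_cont)
    show "((\<lambda>x. C - x * p x) has_real_derivative - (p x + x * p' x)) (at x)"
      if "0 < x" "x < xs" for x
      using that by (auto intro!: derivative_eq_intros p_deriv)
    show "((\<lambda>x. - (p x + x * p' x)) has_real_derivative - (2 * p' x + x * p'' x)) (at x)"
      if "0 < x" "x < xs" for x
      using that by (auto intro!: derivative_eq_intros p_deriv p'_deriv)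
    show "0 \<le> C - 0 * p 0"
      using C(1) params order.trans[of 0 "1 / (r - \<mu>)" C] by simp
    show "- (2 * p' x + x * p'' x) < 0"
      if x: "0 < x" "x < xs" and neg: "C - x * p x < 0" and crit: "- (p x + x * p' x) = 0" for x
    proof -
      have p: "p x > 0" using p_pos x by auto
      have xp': "x * p' x = - p x" using crit by simp
      \<comment> \<open>After multiplication by \<open>x\<close>, \<open>p'\<close> occurs only as
        \<open>x * p' x = - p x\<close>, and the terms in \<open>lam\<close> and \<open>v\<close>
        cancel.\<close>
      have "x * ((r + lam + v x) * p x - (r + lam))
        = ((lam + r) / p x - lam - \<mu> + \<sigma>\<^sup>2) * x * (x * p' x) - u x / p x * (x * p' x)
          - x * v x * (x * p' x) + x * (\<sigma>\<^sup>2 * x\<^sup>2 / 2 * p'' x)"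
        unfolding p_eq[OF x] by (simp add: algebra_simps)
      also have "\<dots> = - (lam + r) * x + (lam + \<mu> - \<sigma>\<^sup>2) * x * p x + u x + x * v x * p x
          + x * (\<sigma>\<^sup>2 * x\<^sup>2 / 2 * p'' x)"
        unfolding xp' using p by (simp add: field_simps)
      finally have "\<sigma>\<^sup>2 * x\<^sup>2 / 2 * (x * p'' x) - \<sigma>\<^sup>2 * x * p x = (r - \<mu>) * (x * p x) - u x"
        by (simp add: algebra_simps)
      \<comment> \<open>As \<open>p' x = - p x / x\<close> here, the factor
        \<open>x * p'' x - 2 * p x / x\<close> is the second derivative of
        \<open>x * p x\<close>.\<close>
      moreover have "\<sigma>\<^sup>2 * x\<^sup>2 / 2 * (x * p'' x - 2 * p x / x)
          = \<sigma>\<^sup>2 * x\<^sup>2 / 2 * (x * p'' x) - \<sigma>\<^sup>2 * x * p x"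
        using x by (simp add: field_simps power2_eq_square)
      ultimately have "\<sigma>\<^sup>2 * x\<^sup>2 / 2 * (x * p'' x - 2 * p x / x) = (r - \<mu>) * (x * p x) - u x"
        by simp
      \<comment> \<open>The choice \<open>C \<ge> 1 / (r - \<mu>)\<close> enters here:
        \<open>x * p x > C\<close> beats \<open>u x \<le> 1\<close>.\<close>
      moreover have "1 < (r - \<mu>) * (x * p x)"
      proof -
        have "1 / (r - \<mu>) < x * p x" using C(1) neg by simp
        then show ?thesis using params by (simp add: pos_divide_less_eq mult.commute)
      qed
      moreover have "u x \<le> 1" using u_bounds[OF x] by simp
      ultimately have "0 < \<sigma>\<^sup>2 * x\<^sup>2 / 2 * (x * p'' x - 2 * p x / x)" by linarith
      then have "0 < x * p'' x - 2 * p x / x"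
        by (rule zero_less_mult_pos) (use params x in simp)
      moreover have "p' x = - p x / x" using xp' x by (simp add: field_simps)
      ultimately show ?thesis by simp
    qed
  qed (use C x in auto)
  then show ?thesis by simp
qed

text \<open>The barrier is \<open>\<kappa> * C / (x + C)\<close>; the shift by \<open>C\<close>
  keeps it bounded at 0, where \<open>\<kappa> \<le> 1 = p 0\<close>. At a contact point
  \<open>(x + C) * p x < \<kappa> * C\<close>, and the positive terms of the rearranged price
  equation are at most \<open>(x + C) * p x * (vmax + lam + \<sigma>\<^sup>2 + r)\<close>, so
  \<open>\<kappa>\<close> is the ratio that makes \<open>C * (r + lam)\<close> dominate
  them.\<close>

lemma price_lower:
  assumes C: "C > 0" "C \<le> xs * p xs"
    and \<kappa>: "\<kappa> = (r + lam) / (vmax + lam + \<sigma>\<^sup>2 + r)"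
    and x: "0 \<le> x" "x \<le> xs"
  shows "\<kappa> * C \<le> (x + C) * p x"
proof -
  have \<kappa>01: "0 < \<kappa>" "\<kappa> \<le> 1"
    using params r_pos by (auto simp: \<kappa> field_simps add_nonneg_pos add_pos_nonneg)
  have "0 \<le> (x + C) * p x - \<kappa> * C"
  proof (rule nonneg_of_no_negative_min[where f = "\<lambda>x. (x + C) * p x - \<kappa> * C" and x = x and a = 0 and b = xs])
    show "continuous_on {0..xs} (\<lambda>x. (x + C) * p x - \<kappa> * C)"
      by (intro continuous_intros p_cont)
    show "((\<lambda>x. (x + C) * p x - \<kappa> * C) has_real_derivative p x + (x + C) * p' x) (at x)"
      if "0 < x" "x < xs" for x
      using that by (auto intro!: derivative_eq_intros p_deriv)
    show "((\<lambda>x. p x + (x + C) * p' x) has_real_derivative 2 * p' x + (x + C) * p'' x) (at x)"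
      if "0 < x" "x < xs" for x
      using that by (auto intro!: derivative_eq_intros p_deriv p'_deriv)
    show "0 \<le> (0 + C) * p 0 - \<kappa> * C"
      using p0 \<kappa>01 C by simp
    have "\<kappa> * C \<le> C" using \<kappa>01 C by simp
    also have "\<dots> \<le> (xs + C) * p xs"
      using C(2) mult_pos_pos[OF C(1) p_pos[of xs]] params by (simp add: distrib_right)
    finally show "0 \<le> (xs + C) * p xs - \<kappa> * C" by simp
    show "2 * p' x + (x + C) * p'' x < 0"
      if x: "0 < x" "x < xs" and neg: "(x + C) * p x - \<kappa> * C < 0"
        and crit: "p x + (x + C) * p' x = 0" for x
    proof -
      define D where "D = x + C"
      have D: "D > 0" "D > C" using x C by (auto simp: D_def)
      have p: "p x > 0" using p_pos x by auto
      have Dp': "D * p' x = - p x" using crit by (simp add: D_def)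
      \<comment> \<open>As for the curves \<open>w / x\<close>, but with the shifted variable
        \<open>D\<close>: criticality turns \<open>D * p' x\<close> into
        \<open>- p x\<close>.\<close>
      have "D * ((r + lam + v x) * p x - (r + lam))
        = ((lam + r) / p x - lam - \<mu> + \<sigma>\<^sup>2) * x * (D * p' x) - u x / p x * (D * p' x)
          - x * v x * (D * p' x) + D * (\<sigma>\<^sup>2 * x\<^sup>2 / 2 * p'' x)"
        unfolding p_eq[OF x] by (simp add: algebra_simps)
      also have "\<dots> = - (lam + r) * x + (lam + \<mu> - \<sigma>\<^sup>2) * x * p x + u x + x * v x * p x
          + D * (\<sigma>\<^sup>2 * x\<^sup>2 / 2 * p'' x)"
        unfolding Dp' using p by (simp add: field_simps)
      finally have "\<sigma>\<^sup>2 * x\<^sup>2 / 2 * (D * p'' x)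
        = D * (r + lam + v x) * p x - C * (r + lam) - (lam + \<mu> - \<sigma>\<^sup>2) * x * p x - u x - x * v x * p x"
        by (simp add: D_def algebra_simps)
      \<comment> \<open>With \<open>x = D - C\<close> the terms in \<open>lam\<close> and
        \<open>v\<close> cancel up to the factor \<open>C\<close> due to the shift.\<close>
      also have "\<dots> = p x * (D * (r - \<mu>) + C * (lam + \<mu> + v x) + \<sigma>\<^sup>2 * x) - C * (r + lam) - u x"
        by (simp add: D_def algebra_simps)
      \<comment> \<open>The factor \<open>D * p'' x - 2 * p x / D\<close> is the second derivative
        of \<open>(x + C) * p x\<close> at the critical point; completing it replaces
        \<open>\<sigma>\<^sup>2 * x\<close> by
        \<open>\<sigma>\<^sup>2 * x * (1 - x / D)\<close>.\<close>
      finally have e: "\<sigma>\<^sup>2 * x\<^sup>2 / 2 * (D * p'' x - 2 * p x / D)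
        = p x * (D * (r - \<mu>) + C * (lam + \<mu> + v x) + \<sigma>\<^sup>2 * x * (1 - x / D)) - C * (r + lam) - u x"
        using D by (simp add: algebra_simps power2_eq_square)
      have "1 - x / D = C / D"
        using D by (simp add: D_def field_simps)
      then have xD: "x * (1 - x / D) \<le> C"
        using x C D by (simp add: D_def field_simps)
      have "D * (r - \<mu>) + C * (lam + \<mu> + v x) + \<sigma>\<^sup>2 * x * (1 - x / D)
          \<le> D * (r - \<mu>) + D * (lam + \<mu> + vmax) + \<sigma>\<^sup>2 * D"
      proof -
        have "C * (lam + \<mu> + v x) \<le> D * (lam + \<mu> + vmax)"
          using v_bounds[OF x] D C params by (intro mult_mono) auto
        moreover have "\<sigma>\<^sup>2 * (x * (1 - x / D)) \<le> \<sigma>\<^sup>2 * D"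
          using xD D by (intro mult_left_mono) auto
        ultimately show ?thesis by (simp add: mult.assoc)
      qed
      also have "\<dots> = D * (vmax + lam + \<sigma>\<^sup>2 + r)" by (simp add: algebra_simps)
      finally have "p x * (D * (r - \<mu>) + C * (lam + \<mu> + v x) + \<sigma>\<^sup>2 * x * (1 - x / D))
          \<le> (D * p x) * (vmax + lam + \<sigma>\<^sup>2 + r)"
        using p by (simp add: mult.assoc mult.left_commute)
      also have "\<dots> < \<kappa> * C * (vmax + lam + \<sigma>\<^sup>2 + r)"
        using neg params r_pos
        by (intro mult_strict_right_mono) (auto simp: D_def add_pos_nonneg add_nonneg_pos)
      also have "\<dots> = C * (r + lam)"
      proof -
        have "vmax + lam + \<sigma>\<^sup>2 + r \<noteq> 0"
          using params r_pos by (smt (verit) zero_le_power2)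
        then show ?thesis by (simp add: \<kappa>)
      qed
      finally have "p x * (D * (r - \<mu>) + C * (lam + \<mu> + v x) + \<sigma>\<^sup>2 * x * (1 - x / D)) < C * (r + lam)" .
      moreover have "0 \<le> u x" using u_bounds[OF x] by simp
      ultimately have "\<sigma>\<^sup>2 * x\<^sup>2 / 2 * (D * p'' x - 2 * p x / D) < 0"
        unfolding e by linarith
      moreover have "0 < \<sigma>\<^sup>2 * x\<^sup>2 / 2" using params x by simp
      ultimately have "D * p'' x - 2 * p x / D < 0"
        by (simp only: mult_less_0_iff) auto
      moreover have "p' x = - p x / D" using Dp' D by (simp add: field_simps)
      ultimately show ?thesis by (simp add: D_def)
    qed
  qed (use x in auto)
  then show ?thesis by simp
qed

text \<open>The right-hand side is a concave supersolution. Discarding \<open>l, k \<ge> 0\<close>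
  and inserting \<open>price_lower\<close>, the drift is at most
  \<open>x * (K * (x + C) / C + \<sigma>\<^sup>2)\<close> with
  \<open>K = vmax + lam + \<sigma>\<^sup>2 + r\<close>. Times the logarithmic derivative
  \<open>\<gamma> * C / (x * (x + C))\<close> this is at most
  \<open>(K + \<sigma>\<^sup>2) * \<gamma> = r\<close>, which dictates
  \<open>\<gamma>\<close>.\<close>

lemma value_upper:
  assumes C: "C > 0" "C \<le> xs * p xs"
    and \<gamma>: "\<gamma> = r / (vmax + lam + 2 * \<sigma>\<^sup>2 + r)"
    and x: "0 \<le> x" "x \<le> xs"
  shows "V x \<le> V xs * (2 * x / (x + C)) powr \<gamma>"
proof -
  define K where "K = vmax + lam + \<sigma>\<^sup>2 + r"
  have K: "K > 0" "r \<le> K" using params r_pos by (auto simp: K_def add_pos_nonneg add_nonneg_pos)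
  have \<gamma>K: "\<gamma> = r / (K + \<sigma>\<^sup>2)" by (simp add: \<gamma> K_def algebra_simps)
  have K\<sigma>: "0 < K + \<sigma>\<^sup>2" using K by (simp add: add_pos_nonneg)
  have \<gamma>01: "0 < \<gamma>" "\<gamma> \<le> 1"
    using K K\<sigma> r_pos params by (auto simp: \<gamma>K divide_le_eq add_increasing2)
  define \<psi> where "\<psi> = (\<lambda>x. V xs * (2 * x / (x + C)) powr \<gamma>)"
  \<comment> \<open>\<open>g\<close> is the logarithmic derivative of \<open>\<psi>\<close>, so the
    second derivative of \<open>\<psi>\<close> is
    \<open>\<psi> x * (g x * g x + g' x)\<close>.\<close>
  define g where "g = (\<lambda>x. \<gamma> * C / (x * (x + C)))"
  define g' where "g' = (\<lambda>x. - \<gamma> * C * (2 * x + C) / (x * (x + C))\<^sup>2)"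
  have \<psi>pos: "0 < \<psi> x" if "0 < x" for x
    using that C V_end by (simp add: \<psi>_def)
  have \<psi>': "(\<psi> has_real_derivative \<psi> x * g x) (at x)" if "0 < x" for x
  proof -
    have t: "((\<lambda>x. 2 * x / (x + C)) has_real_derivative 2 * C / (x + C)\<^sup>2) (at x)"
      using that C by (auto intro!: derivative_eq_intros simp: field_simps power2_eq_square)
    have pos: "2 * x / (x + C) > 0" using that C by simp
    have "((\<lambda>x. (2 * x / (x + C)) powr \<gamma>) has_real_derivative
        \<gamma> * (2 * x / (x + C)) powr (\<gamma> - 1) * (2 * C / (x + C)\<^sup>2)) (at x)"
      using DERIV_fun_powr[OF t pos, of \<gamma>] by simp
    then have "(\<psi> has_real_derivative
        V xs * (\<gamma> * (2 * x / (x + C)) powr (\<gamma> - 1) * (2 * C / (x + C)\<^sup>2))) (at x)"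
      unfolding \<psi>_def by (rule DERIV_cmult)
    moreover have "(2 * x / (x + C)) powr (\<gamma> - 1) = (2 * x / (x + C)) powr \<gamma> * ((x + C) / (2 * x))"
      using pos that C by (simp add: powr_diff)
    then have "V xs * (\<gamma> * (2 * x / (x + C)) powr (\<gamma> - 1) * (2 * C / (x + C)\<^sup>2)) = \<psi> x * g x"
      using that C by (simp add: \<psi>_def g_def power2_eq_square)
    ultimately show ?thesis by simp
  qed
  have g': "(g has_real_derivative g' x) (at x)" if "0 < x" for x
    unfolding g_def g'_def using that C
    by (auto intro!: derivative_eq_intros simp: power2_eq_square)
  have "0 \<le> \<psi> x - V x"
  proof (rule nonneg_of_no_negative_min[where f = "\<lambda>x. \<psi> x - V x" and x = x and a = 0 and b = xs])
    have "continuous_on {0..xs} \<psi>"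
      unfolding \<psi>_def using C \<gamma>01 by (intro continuous_intros continuous_on_powr') auto
    then show "continuous_on {0..xs} (\<lambda>x. \<psi> x - V x)"
      by (intro continuous_intros V_cont)
    show "((\<lambda>x. \<psi> x - V x) has_real_derivative \<psi> x * g x - V' x) (at x)"
      if "0 < x" "x < xs" for x
      using that by (auto intro!: derivative_eq_intros V_deriv \<psi>')
    show "((\<lambda>x. \<psi> x * g x - V' x) has_real_derivative
        (\<psi> x * g x * g x + \<psi> x * g' x) - V'' x) (at x)"
      if "0 < x" "x < xs" for x
      using that by (auto intro!: derivative_eq_intros V'_deriv \<psi>' g')
    show "0 \<le> \<psi> 0 - V 0" using V0 by (simp add: \<psi>_def)
    \<comment> \<open>The factor 2 in the barrier serves this end: \<open>p \<le> 1\<close> forces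
      \<open>C \<le> xs\<close>, hence \<open>\<psi> xs \<ge> V xs\<close>.\<close>
    have "C \<le> xs" using order.trans[OF C(2), of xs] p_le[of xs] params by simp
    then have "1 \<le> 2 * xs / (xs + C)" using C params by (simp add: field_simps)
    then have "1 \<le> (2 * xs / (xs + C)) powr \<gamma>" using \<gamma>01 by (simp add: ge_one_powr_ge_zero)
    then show "0 \<le> \<psi> xs - V xs" using V_end by (simp add: \<psi>_def)
    show "(\<psi> x * g x * g x + \<psi> x * g' x) - V'' x < 0"
      if x: "0 < x" "x < xs" and neg: "\<psi> x - V x < 0" and crit: "\<psi> x * g x - V' x = 0" for x
    proof -
      have p: "p x > 0" using p_pos x by auto
      have gpos: "g x > 0" using x C \<gamma>01 by (simp add: g_def)
      have V': "V' x = \<psi> x * g x" "0 < V' x"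
        using crit mult_pos_pos[OF \<psi>pos[OF x(1)] gpos] by auto
      \<comment> \<open>Concavity of \<open>\<psi>\<close>, from
        \<open>\<gamma> \<le> 1\<close>.\<close>
      have sec: "g x * g x + g' x \<le> 0"
      proof -
        have "g x * g x = \<gamma> * C * (\<gamma> * C) / (x * (x + C))\<^sup>2"
          by (simp add: g_def power2_eq_square)
        moreover have "g' x = \<gamma> * C * (- (2 * x + C)) / (x * (x + C))\<^sup>2"
          by (simp only: g'_def mult_minus_left mult_minus_right)
        ultimately have "g x * g x + g' x = \<gamma> * C * (\<gamma> * C - (2 * x + C)) / (x * (x + C))\<^sup>2"
          by (simp only: add_divide_distrib[symmetric] distrib_left[symmetric] diff_conv_add_uminus)
        moreover have "\<gamma> * C - (2 * x + C) \<le> 0"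
          using mult_right_mono[OF \<gamma>01(2) less_imp_le[OF C(1)]] x by linarith
        ultimately show ?thesis
          using x C \<gamma>01 by (auto intro!: divide_nonpos_nonneg mult_nonneg_nonpos)
      qed
      have low: "(r + lam) / K * C \<le> (x + C) * p x"
        using price_lower[OF C refl, of x] x by (simp add: K_def)
      have "(lam + r) / p x \<le> K * (x + C) / C"
        using low p K C by (simp add: field_simps)
      then have "((lam + r) / p x - lam - \<mu> + \<sigma>\<^sup>2) * (x * V' x)
          \<le> (K * (x + C) / C + \<sigma>\<^sup>2) * (x * V' x)"
        using V'(2) x params by (intro mult_right_mono) auto
      also have "\<dots> = (K * (x + C) / C + \<sigma>\<^sup>2) * (\<gamma> * C / (x + C)) * \<psi> x"
        using x by (simp add: V'(1) g_def)
      also have "\<dots> = (K + \<sigma>\<^sup>2 * (C / (x + C))) * \<gamma> * \<psi> x"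
      proof -
        have "K * (x + C) / C * (\<gamma> * C / (x + C)) = K * \<gamma>"
          using x C by simp
        moreover have "\<sigma>\<^sup>2 * (\<gamma> * C / (x + C)) = \<sigma>\<^sup>2 * (C / (x + C)) * \<gamma>"
          by simp
        ultimately show ?thesis by (simp only: distrib_right)
      qed
      also have "\<dots> \<le> (K + \<sigma>\<^sup>2) * \<gamma> * \<psi> x"
        using x C \<gamma>01 \<psi>pos[OF x(1)]
        by (intro mult_right_mono add_left_mono mult_left_le) (auto simp: divide_le_eq)
      also have "\<dots> = r * \<psi> x" using K\<sigma> by (simp add: \<gamma>K)
      also have "\<dots> < r * V x" using neg r_pos by simp
      \<comment> \<open>The first-order term is below \<open>r * V x\<close>, so the value equation
        forces \<open>V'' x > 0\<close>, while \<open>\<psi>\<close> is concave.\<close>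
      finally have "0 < \<sigma>\<^sup>2 * x\<^sup>2 / 2 * V'' x"
        using V_eq[OF x] l_nonneg[OF x] k_nonneg[OF x] by (simp add: mult.assoc)
      then have "0 < V'' x"
        by (rule zero_less_mult_pos) (use params x in simp)
      moreover have "\<psi> x * g x * g x + \<psi> x * g' x = \<psi> x * (g x * g x + g' x)"
        by (simp add: algebra_simps)
      moreover have "\<dots> \<le> 0"
        using sec \<psi>pos[OF x(1)] by (simp add: mult_nonneg_nonpos)
      ultimately show ?thesis by linarith
    qed
  qed (use x in auto)
  then show ?thesis by (simp add: \<psi>_def)
qed

text \<open>The barrier vanishes at \<open>a\<close>, where \<open>V \<ge> 0\<close> suffices, and
  stays below \<open>V xs\<close> at \<open>xs\<close>. In between, \<open>p \<le> C / x\<close>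
  gives a drift of order \<open>r * x\<^sup>2 / C\<close>, which outweighs the losses
  \<open>l \<le> V' / p\<close> and \<open>k \<le> vmax * (x * V')\<close>; \<open>a\<close> is
  chosen so that this holds for all \<open>x > a\<close>.\<close>

lemma value_lower:
  assumes C: "1 / (r - \<mu>) \<le> C" "xs * p xs \<le> C"
    and a: "a = (1 + (r + vmax) * C) / r"
    and x: "a \<le> x" "x \<le> xs"
  shows "V xs * (1 - a / x) \<le> V x"
proof -
  have Cpos: "C > 0"
    using C(1) params by (smt (verit) divide_pos_pos)
  have ra: "r * a = 1 + (r + vmax) * C" using r_pos by (simp add: a)
  have apos: "a > 0" using r_pos params Cpos by (simp add: a add_pos_pos)
  have "0 \<le> V x - V xs * (1 - a / x)"
  proof (rule nonneg_of_no_negative_min[where f = "\<lambda>x. V x - V xs * (1 - a / x)" and x = x and a = a and b = xs])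
    show "continuous_on {a..xs} (\<lambda>x. V x - V xs * (1 - a / x))"
      using apos by (intro continuous_intros continuous_on_subset[OF V_cont]) auto
    show "((\<lambda>x. V x - V xs * (1 - a / x)) has_real_derivative V' x - V xs * a / x\<^sup>2) (at x)"
      if "a < x" "x < xs" for x
      using that apos by (auto intro!: derivative_eq_intros V_deriv simp: power2_eq_square)
    show "((\<lambda>x. V' x - V xs * a / x\<^sup>2) has_real_derivative V'' x + 2 * V xs * a / x ^ 3) (at x)"
      if "a < x" "x < xs" for x
      using that apos
      by (auto intro!: derivative_eq_intros V'_deriv simp: field_simps power2_eq_square power3_eq_cube)
    show "0 \<le> V a - V xs * (1 - a / a)"
      using V_nonneg[of a] apos x by simp
    show "0 \<le> V xs - V xs * (1 - a / xs)"
      using V_end apos params by (simp add: algebra_simps)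
    show "V'' x + 2 * V xs * a / x ^ 3 < 0"
      if x: "a < x" "x < xs" and neg: "V x - V xs * (1 - a / x) < 0"
        and crit: "V' x - V xs * a / x\<^sup>2 = 0" for x
    proof -
      have x0: "0 < x" "x < xs" using x apos by auto
      have p: "p x > 0" "p x \<le> 1" using p_pos p_le x0 by auto
      have V': "V' x = V xs * a / x\<^sup>2" "0 < V' x" using crit V_end apos x0 by auto
      \<comment> \<open>This makes \<open>r * x - 1\<close>, the coefficient of
        \<open>1 / p x\<close> left after subtracting the bound on \<open>l\<close>,
        nonnegative.\<close>
      have rx: "1 \<le> r * x"
      proof -
        have "1 \<le> r * a" unfolding ra using r_pos params Cpos by simp
        also have "\<dots> \<le> r * x" using x r_pos by simp
        finally show ?thesis .
      qed
      have px: "x / C \<le> 1 / p x"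
        using price_upper[OF C, of x] x0 p Cpos by (simp add: field_simps)
      \<comment> \<open>Two lower bounds for \<open>1 / p x\<close> are used: \<open>x / C\<close>
        with the weight \<open>r * x - 1\<close>, and 1 with the weight \<open>lam * x\<close>,
        which absorbs the term \<open>- lam * x\<close> of the drift.\<close>
      have "(r * x - 1) * (x / C) + lam * x * 1 \<le> (r * x - 1) * (1 / p x) + lam * x * (1 / p x)"
        using px rx p params x0 by (intro add_mono mult_left_mono) auto
      then have drift: "(r * x - 1) * (x / C) - (\<mu> + vmax) * x + \<sigma>\<^sup>2 * x
          \<le> ((lam + r) / p x - lam - \<mu> + \<sigma>\<^sup>2) * x - 1 / p x - vmax * x"
        by (simp add: algebra_simps add_divide_distrib diff_divide_distrib)
      \<comment> \<open>After multiplication by \<open>x * C\<close>, the value of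
        \<open>r * a\<close> leaves a difference that is a sum of nonnegative terms for
        \<open>x > a\<close>.\<close>
      have main: "r * (1 - a / x) \<le> a * (r / C - (1 / C + \<mu> + vmax) / x)"
      proof -
        have "a * (r * x - 1) - a * (\<mu> + vmax) * C - r * (x - a) * C
            = (x - a) * (1 + vmax * C) + a * C * (r - \<mu>)"
          using ra by algebra
        moreover have "0 \<le> (x - a) * (1 + vmax * C) + a * C * (r - \<mu>)"
          using x apos Cpos params by (intro add_nonneg_nonneg mult_nonneg_nonneg) auto
        ultimately have "r * (x - a) * C \<le> a * (r * x - 1) - a * (\<mu> + vmax) * C"
          by linarith
        then have "r * (x - a) * C / (x * C) \<le> (a * (r * x - 1) - a * (\<mu> + vmax) * C) / (x * C)"
          using x0 Cpos by (intro divide_right_mono) auto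
        moreover have "r * (x - a) * C / (x * C) = r * (1 - a / x)"
          using x0 Cpos by (simp add: field_simps)
        moreover have "(a * (r * x - 1) - a * (\<mu> + vmax) * C) / (x * C)
            = a * (r / C - (1 / C + \<mu> + vmax) / x)"
          using x0 Cpos by (simp add: field_simps)
        ultimately show ?thesis by simp
      qed
      have "r * V x < r * (V xs * (1 - a / x))" using neg r_pos by simp
      also have "\<dots> = V xs * (r * (1 - a / x))" by simp
      also have "\<dots> \<le> V xs * (a * (r / C - (1 / C + \<mu> + vmax) / x))"
        using main V_end by (intro mult_left_mono) auto
      also have "\<dots> = ((r * x - 1) * (x / C) - (\<mu> + vmax) * x) * V' x"
        using x0 Cpos by (simp add: V'(1) field_simps power2_eq_square)
      \<comment> \<open>The split-off \<open>- \<sigma>\<^sup>2 * x * V' x\<close> is the diffusion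
        term of the barrier, as \<open>V' x = V xs * a / x\<^sup>2\<close> here.\<close>
      also have "\<dots> = ((r * x - 1) * (x / C) - (\<mu> + vmax) * x + \<sigma>\<^sup>2 * x) * V' x - \<sigma>\<^sup>2 * x * V' x"
        by (simp add: algebra_simps)
      also have "\<dots> \<le> (((lam + r) / p x - lam - \<mu> + \<sigma>\<^sup>2) * x - 1 / p x - vmax * x) * V' x
          - \<sigma>\<^sup>2 * x * V' x"
        using drift V'(2) by (intro diff_right_mono mult_right_mono) auto
      also have "\<dots> = ((lam + r) / p x - lam - \<mu> + \<sigma>\<^sup>2) * x * V' x - V' x / p x
          - vmax * (x * V' x) - \<sigma>\<^sup>2 * x * V' x"
        by (simp add: algebra_simps)
      also have "\<dots> \<le> r * V x - \<sigma>\<^sup>2 * x\<^sup>2 / 2 * V'' x - \<sigma>\<^sup>2 * x * V' x"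
        using V_eq[OF x0] l_le[OF x0] k_le[OF x0] V'(2) by linarith
      finally have "\<sigma>\<^sup>2 * x\<^sup>2 / 2 * V'' x + \<sigma>\<^sup>2 * x * V' x < 0" by simp
      moreover have "\<sigma>\<^sup>2 * x\<^sup>2 / 2 * V'' x + \<sigma>\<^sup>2 * x * V' x
          = \<sigma>\<^sup>2 * x\<^sup>2 / 2 * (V'' x + 2 * V xs * a / x ^ 3)"
        using x0 by (simp add: V'(1) field_simps power2_eq_square power3_eq_cube)
      ultimately have "\<sigma>\<^sup>2 * x\<^sup>2 / 2 * (V'' x + 2 * V xs * a / x ^ 3) < 0" by simp
      moreover have "0 < \<sigma>\<^sup>2 * x\<^sup>2 / 2" using params x0 by simp
      ultimately show ?thesis
        by (simp only: mult_less_0_iff) auto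
    qed
  qed (use x in auto)
  then show ?thesis by simp
qed

end

section \<open>From the boundary value problem to the abstract estimates\<close>

lemma has_real_derivative_interior:
  assumes "(f has_real_derivative d) (at x within {a..b})" "a < x" "x < b"
  shows "(f has_real_derivative d) (at x)"
  using assms at_within_Icc_at[of a x b] by simp

text \<open>The witnesses are the conjugates along the solution and their maximizers. A maximizer is
  the derivative of the conjugate; for \<open>c\<close> at the slope \<open>x * V' x\<close> it is
  the control \<open>v x\<close> itself, so the same \<open>v\<close> appears in
  \<open>hamiltonian_\<xi>\<close>.\<close>

lemma BVP_solution_equilibrium:
  assumes par: "r > \<mu>" "lam \<ge> 0" "\<mu> \<ge> 0" "\<sigma> > 0" "B > 0" "\<delta> > 0" "vmax > 0" "xs > 0"
    and L: "cost_function \<delta> 1 L" and c: "cost_function \<delta> vmax c"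
    and BVP: "BVP_solution L c vmax r \<mu> lam \<sigma> B \<theta> xs V p"
  shows "\<exists>V' V'' p' p'' l k u v. debt_equilibrium r \<mu> lam \<sigma> vmax xs V V' V'' p p' p'' l k u v"
proof -
  have p01: "\<And>x. x \<in> {0..xs} \<Longrightarrow> 0 < p x \<and> p x \<le> 1"
    and bc: "V 0 = 0" "V xs = B" "p 0 = 1"
    using BVP by (auto simp: BVP_solution_def)
  obtain V' V'' p' p'' v where
    CV: "C2_on {0..xs} V V' V''" and Cp: "C2_on {0..xs} p p' p''" and
    eqV: "\<And>x. x \<in> {0..xs} \<Longrightarrow> r * V x = hamiltonian L c vmax r \<mu> lam \<sigma> x (V' x) (p x)
      + \<sigma>\<^sup>2 * x\<^sup>2 / 2 * V'' x" and
    eqp: "\<And>x. x \<in> {0..xs} \<Longrightarrow> (r + lam + v x) * p x - (r + lam)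
      = hamiltonian_\<xi> L c vmax r \<mu> lam \<sigma> x (V' x) (p x) * p' x + \<sigma>\<^sup>2 * x\<^sup>2 / 2 * p'' x" and
    arg: "\<And>x. x \<in> {0..xs} \<Longrightarrow>
      is_arg_min (\<lambda>w. infinity_ext vmax c w - ereal (w * x * V' x)) (\<lambda>w. 0 \<le> w) (v x)"
    using BVP unfolding BVP_solution_def by blast
  define Lc where "Lc = (\<lambda>\<eta>. real_of_ereal (convex_conjugate (infinity_ext 1 L) \<eta>))"
  define cc where "cc = (\<lambda>\<eta>. real_of_ereal (convex_conjugate (infinity_ext vmax c) \<eta>))"
  have "\<exists>z. z \<in> {0..<1} \<and> (\<forall>y\<in>{0..<1}. \<rho> * y - L y \<le> \<rho> * z - L z)" for \<rho>
    by (rule cost_function_maximizer[OF L, of \<rho>]) auto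
  then obtain U where U: "\<And>\<rho>. U \<rho> \<in> {0..<1}"
    "\<And>\<rho> y. y \<in> {0..<1} \<Longrightarrow> \<rho> * y - L y \<le> \<rho> * U \<rho> - L (U \<rho>)"
    by metis
  have Lc': "(Lc has_real_derivative U \<rho>) (at \<rho>)" for \<rho>
    unfolding Lc_def by (rule real_conjugate_has_derivative[OF L _ par(6)]) (use U in auto)
  have v: "v x \<in> {0..<vmax}"
    "\<And>y. y \<in> {0..<vmax} \<Longrightarrow> x * V' x * y - c y \<le> x * V' x * v x - c (v x)"
    if x: "x \<in> {0..xs}" for x
  proof -
    have v0: "0 \<le> v x" and min: "\<And>y. 0 \<le> y \<Longrightarrow>
      \<not> infinity_ext vmax c y - ereal (y * x * V' x) < infinity_ext vmax c (v x) - ereal (v x * x * V' x)"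
      using arg[OF x] by (auto simp: is_arg_min_def)
    \<comment> \<open>Outside \<open>{0..<vmax}\<close> the objective is infinite, whereas
      \<open>w = 0\<close> gives a finite value, so the minimizer lies inside.\<close>
    show mem: "v x \<in> {0..<vmax}"
      using min[of 0] v0 par by (auto simp: infinity_ext_def split: if_splits)
    show "x * V' x * y - c y \<le> x * V' x * v x - c (v x)" if "y \<in> {0..<vmax}" for y
      using min[of y] that mem by (auto simp: infinity_ext_def algebra_simps)
  qed
  have cc': "(cc has_real_derivative v x) (at (x * V' x))" if "x \<in> {0..xs}" for x
    unfolding cc_def by (rule real_conjugate_has_derivative[OF c par(7) par(6)]) (use v that in auto)
  \<comment> \<open>\<open>hamiltonian_\<xi>\<close> is defined through \<open>deriv\<close>, so its
    value is obtained by exhibiting a derivative; the chain rule contributes the factors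
    \<open>1 / p x\<close> and \<open>x\<close>.\<close>
  have H\<xi>: "hamiltonian_\<xi> L c vmax r \<mu> lam \<sigma> x (V' x) (p x)
      = ((lam + r) / p x - lam - \<mu> + \<sigma>\<^sup>2) * x - U (V' x / p x) / p x - x * v x"
    if x: "x \<in> {0..xs}" for x
    unfolding hamiltonian_\<xi>_def
  proof (rule DERIV_imp_deriv)
    have 1: "((\<lambda>\<eta>. Lc (\<eta> / p x)) has_real_derivative U (V' x / p x) * (1 / p x)) (at (V' x))"
      by (rule DERIV_chain2[where g = "\<lambda>\<eta>. \<eta> / p x", OF Lc'])
        (use p01[OF x] in \<open>auto intro!: derivative_eq_intros\<close>)
    have 2: "((\<lambda>\<eta>. cc (x * \<eta>)) has_real_derivative v x * x) (at (V' x))"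
      by (rule DERIV_chain2[where g = "\<lambda>\<eta>. x * \<eta>", OF cc'[OF x]])
        (auto intro!: derivative_eq_intros)
    have eq: "(\<lambda>\<eta>. hamiltonian L c vmax r \<mu> lam \<sigma> x \<eta> (p x))
        = (\<lambda>\<eta>. - Lc (\<eta> / p x) - cc (x * \<eta>) + ((lam + r) / p x - lam - \<mu> + \<sigma>\<^sup>2) * x * \<eta>)"
      by (simp add: hamiltonian_def Lc_def cc_def)
    show "((\<lambda>\<eta>. hamiltonian L c vmax r \<mu> lam \<sigma> x \<eta> (p x)) has_real_derivative
      ((lam + r) / p x - lam - \<mu> + \<sigma>\<^sup>2) * x - U (V' x / p x) / p x - x * v x) (at (V' x))"
      unfolding eq by (auto intro!: derivative_eq_intros 1 2)
  qed
  note Cd = CV[unfolded C2_on_def] Cp[unfolded C2_on_def]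
  have "debt_equilibrium r \<mu> lam \<sigma> vmax xs V V' V'' p p' p''
    (\<lambda>x. Lc (V' x / p x)) (\<lambda>x. cc (x * V' x)) (\<lambda>x. U (V' x / p x)) v"
  proof
    show "continuous_on {0..xs} V" "continuous_on {0..xs} p"
      using Cd by (auto intro!: DERIV_continuous_on)
    fix x assume x: "0 < x" "x < xs"
    then have xi: "x \<in> {0..xs}" by simp
    show "(V has_real_derivative V' x) (at x)" "(V' has_real_derivative V'' x) (at x)"
      "(p has_real_derivative p' x) (at x)" "(p' has_real_derivative p'' x) (at x)"
      using Cd xi x by (auto intro: has_real_derivative_interior)
    show "r * V x = - Lc (V' x / p x) - cc (x * V' x)
        + ((lam + r) / p x - lam - \<mu> + \<sigma>\<^sup>2) * x * V' x + \<sigma>\<^sup>2 * x\<^sup>2 / 2 * V'' x"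
      using eqV[OF xi] by (simp add: hamiltonian_def Lc_def cc_def)
    show "(r + lam + v x) * p x - (r + lam)
        = (((lam + r) / p x - lam - \<mu> + \<sigma>\<^sup>2) * x - U (V' x / p x) / p x - x * v x) * p' x
          + \<sigma>\<^sup>2 * x\<^sup>2 / 2 * p'' x"
      using eqp[OF xi] H\<xi>[OF xi] by simp
    show "0 \<le> Lc (V' x / p x)" "0 \<le> cc (x * V' x)"
      unfolding Lc_def cc_def using real_conjugate_bounds(1)[OF L] real_conjugate_bounds(1)[OF c] par
      by auto
    show "U (V' x / p x) \<in> {0..1}" "v x \<in> {0..vmax}"
      using U(1)[of "V' x / p x"] v(1)[OF xi] by auto
    assume V': "0 \<le> V' x"
    show "Lc (V' x / p x) \<le> V' x / p x"
      unfolding Lc_def using real_conjugate_bounds(2)[OF L, of "V' x / p x"] V' p01[OF xi] by simp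
    show "cc (x * V' x) \<le> vmax * (x * V' x)"
      unfolding cc_def using real_conjugate_bounds(2)[OF c, of "x * V' x"] V' x par by simp
  qed (use par p01 bc in auto)
  then show ?thesis by blast
qed

section \<open>Limits as the bankruptcy threshold tends to infinity\<close>

theorem theorem3p3:
  fixes r \<mu> lam \<sigma> B \<delta>\<^sub>0 vmax :: real
    and L c \<theta> :: "real \<Rightarrow> real"
    and V p :: "real \<Rightarrow> real \<Rightarrow> real"
  assumes "r > \<mu>" and "lam \<ge> 0" and "\<mu> \<ge> 0" and "lam + \<mu> > 0"
    and "\<sigma> > 0" and "B > 0"
    and "\<delta>\<^sub>0 > 0" and "vmax > 0"
    and A1: "cost_function \<delta>\<^sub>0 1 L"
    and A2: "cost_function \<delta>\<^sub>0 vmax c"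
    and theta: "\<forall>s>0. 0 < \<theta> s \<and> \<theta> s \<le> 1"
    and BVP: "\<forall>xs>0. BVP_solution L c vmax r \<mu> lam \<sigma> B \<theta> xs (\<lambda>x. V x xs) (\<lambda>x. p x xs)"
  shows "(Liminf at_top (\<lambda>s. ereal (\<theta> s * s)) = \<infinity> \<longrightarrow>
            (\<forall>x\<ge>0. ((\<lambda>xs. V x xs) \<longlongrightarrow> 0) at_top)) \<and>
         (\<forall>C\<^sub>1::real. Limsup at_top (\<lambda>s. ereal (\<theta> s * s)) = ereal C\<^sub>1 \<longrightarrow>
            (\<forall>x \<ge> 2 * (r + vmax + (1 + C\<^sub>1 * (r + vmax)) * (r - \<mu>)) / (r * (r - \<mu>)).
               Liminf at_top (\<lambda>xs. ereal (V x xs))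
                 \<ge> ereal (r * B / (2 * (2 * r + vmax - \<mu>)))))"
proof (intro conjI allI impI)
  have r: "r > 0" using assms by simp
  have sol: "\<exists>V' V'' p' p'' l k u v.
      debt_equilibrium r \<mu> lam \<sigma> vmax xs (\<lambda>x. V x xs) V' V'' (\<lambda>x. p x xs) p' p'' l k u v"
    if "xs > 0" for xs
    by (rule BVP_solution_equilibrium[of \<mu> r lam \<sigma> B \<delta>\<^sub>0 vmax xs L c \<theta>]) (use assms that in auto)
  have ends: "V xs xs = B" "p xs xs = \<theta> xs" if "xs > 0" for xs
    using BVP that by (auto simp: BVP_solution_def)
  {
    fix x :: real
    assume lim: "Liminf at_top (\<lambda>s. ereal (\<theta> s * s)) = \<infinity>" and x: "0 \<le> x"
    have C_lim: "filterlim (\<lambda>s. \<theta> s * s) at_top at_top"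
      unfolding filterlim_at_top_dense
    proof
      fix Z
      have "ereal Z < Liminf at_top (\<lambda>s. ereal (\<theta> s * s))" using lim by simp
      from less_LiminfD[OF this] show "\<forall>\<^sub>F s in at_top. Z < \<theta> s * s" by simp
    qed
    define \<gamma> where "\<gamma> = r / (vmax + lam + 2 * \<sigma>\<^sup>2 + r)"
    have \<gamma>: "\<gamma> > 0"
      using assms r by (simp add: \<gamma>_def add_pos_nonneg add_nonneg_pos)
    have "((\<lambda>s. 2 * x / (x + \<theta> s * s)) \<longlongrightarrow> 0) at_top"
      by (intro real_tendsto_divide_at_top[OF tendsto_const]
          filterlim_tendsto_add_at_top[OF tendsto_const] C_lim)
    moreover have "\<forall>\<^sub>F s in at_top. 0 \<le> 2 * x / (x + \<theta> s * s)"
      using eventually_gt_at_top[of 0] by eventually_elim (use x theta in \<open>auto intro!: divide_nonneg_nonneg add_nonneg_nonneg simp: less_imp_le\<close>)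
    ultimately have "((\<lambda>s. (2 * x / (x + \<theta> s * s)) powr \<gamma>) \<longlongrightarrow> 0) at_top"
      using \<gamma> by (intro tendsto_zero_powrI[OF _ tendsto_const]) auto
    then have upper: "((\<lambda>s. B * (2 * x / (x + \<theta> s * s)) powr \<gamma>) \<longlongrightarrow> 0) at_top"
      using tendsto_mult_right_zero by blast
    \<comment> \<open>\<open>C = \<theta> s * s\<close> is threshold times boundary price, so the
      hypothesis on \<open>C\<close> in \<open>value_upper\<close> holds with equality.\<close>
    have bounds: "0 \<le> V x s \<and> V x s \<le> B * (2 * x / (x + \<theta> s * s)) powr \<gamma>" if s: "0 < s" "x < s" for s
    proof -
      obtain V' V'' p' p'' l k u v where
        "debt_equilibrium r \<mu> lam \<sigma> vmax s (\<lambda>x. V x s) V' V'' (\<lambda>x. p x s) p' p'' l k u v"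
        using sol[OF s(1)] by blast
      then interpret debt_equilibrium r \<mu> lam \<sigma> vmax s "\<lambda>x. V x s" V' V'' "\<lambda>x. p x s" p' p'' l k u v .
      show ?thesis
        using value_upper[of "\<theta> s * s", OF _ _ \<gamma>_def, of x] V_nonneg[of x] ends[OF s(1)] s x theta
        by (simp add: mult.commute)
    qed
    have ev: "\<forall>\<^sub>F s in at_top. 0 < s \<and> x < s"
      by (intro eventually_conj eventually_gt_at_top)
    show "((\<lambda>xs. V x xs) \<longlongrightarrow> 0) at_top"
    proof (rule tendsto_sandwich[OF _ _ tendsto_const upper])
      show "\<forall>\<^sub>F s in at_top. 0 \<le> V x s"
        using ev by eventually_elim (use bounds in auto)
      show "\<forall>\<^sub>F s in at_top. V x s \<le> B * (2 * x / (x + \<theta> s * s)) powr \<gamma>"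
        using ev by eventually_elim (use bounds in auto)
    qed
  next
    fix C\<^sub>1 x :: real
    assume lim: "Limsup at_top (\<lambda>s. ereal (\<theta> s * s)) = ereal C\<^sub>1"
      and x: "2 * (r + vmax + (1 + C\<^sub>1 * (r + vmax)) * (r - \<mu>)) / (r * (r - \<mu>)) \<le> x"
    \<comment> \<open>Adding \<open>1 / (r - \<mu>)\<close> serves twice: \<open>C\<close> strictly
      exceeds the limsup, so \<open>\<theta> s * s < C\<close> eventually, and
      \<open>C \<ge> 1 / (r - \<mu>)\<close> because \<open>C\<^sub>1 \<ge> 0\<close>.\<close>
    define C where "C = 1 / (r - \<mu>) + C\<^sub>1"
    define a where "a = (1 + (r + vmax) * C) / r"
    \<comment> \<open>The threshold for \<open>x\<close> in the statement is exactly
      \<open>2 * a\<close>, which makes \<open>1 - a / x \<ge> 1 / 2\<close>.\<close>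
    have x2a: "2 * a \<le> x"
    proof -
      have "2 * a = 2 * (r + vmax + (1 + C\<^sub>1 * (r + vmax)) * (r - \<mu>)) / (r * (r - \<mu>))"
        using r \<open>r > \<mu>\<close> by (simp add: a_def C_def field_simps)
      then show ?thesis using x by simp
    qed
    have "Limsup at_top (\<lambda>s. ereal (\<theta> s * s)) < ereal C"
      using lim \<open>r > \<mu>\<close> by (simp add: C_def)
    from Limsup_lessD[OF this] have small: "\<forall>\<^sub>F s in at_top. \<theta> s * s < C" by simp
    have "0 \<le> Limsup at_top (\<lambda>s. ereal (\<theta> s * s))"
    proof (rule le_Limsup)
      show "\<forall>\<^sub>F s in at_top. 0 \<le> ereal (\<theta> s * s)"
        using eventually_gt_at_top[of 0] by eventually_elim (use theta in \<open>auto simp: less_imp_le\<close>)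
    qed simp
    then have C1: "0 \<le> C\<^sub>1" using lim by simp
    have C: "1 / (r - \<mu>) \<le> C" using C1 by (simp add: C_def)
    have "0 < 1 / (r - \<mu>)" using \<open>r > \<mu>\<close> by simp
    then have "0 < C" using C by linarith
    then have a0: "0 < a" using r \<open>vmax > 0\<close> by (simp add: a_def add_pos_pos)
    have low: "B / 2 \<le> V x s" if s: "0 < s" "x < s" "\<theta> s * s < C" for s
    proof -
      obtain V' V'' p' p'' l k u v where
        "debt_equilibrium r \<mu> lam \<sigma> vmax s (\<lambda>x. V x s) V' V'' (\<lambda>x. p x s) p' p'' l k u v"
        using sol[OF s(1)] by blast
      then interpret debt_equilibrium r \<mu> lam \<sigma> vmax s "\<lambda>x. V x s" V' V'' "\<lambda>x. p x s" p' p'' l k u v .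
      have "B * (1 - a / x) \<le> V x s"
        using value_lower[OF C _ a_def, of x] ends[OF s(1)] s x2a a0 by (simp add: mult.commute)
      moreover have "a / x \<le> 1 / 2" using x2a a0 by (simp add: field_simps)
      then have "B * (1 / 2) \<le> B * (1 - a / x)" using \<open>B > 0\<close> by (intro mult_left_mono) auto
      ultimately show ?thesis by linarith
    qed
    \<comment> \<open>The constant of the statement is \<open>B / 2\<close> times a factor at most
      1, since \<open>r + vmax - \<mu> > 0\<close>.\<close>
    have "r * B / (2 * (2 * r + vmax - \<mu>)) = B / 2 * (r / (2 * r + vmax - \<mu>))" by simp
    also have "\<dots> \<le> B / 2 * 1"
      using assms r by (intro mult_left_mono) (auto simp: divide_le_eq)
    finally have le: "r * B / (2 * (2 * r + vmax - \<mu>)) \<le> B / 2" by simp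
    show "ereal (r * B / (2 * (2 * r + vmax - \<mu>))) \<le> Liminf at_top (\<lambda>xs. ereal (V x xs))"
    proof (rule Liminf_bounded)
      show "\<forall>\<^sub>F s in at_top. ereal (r * B / (2 * (2 * r + vmax - \<mu>))) \<le> ereal (V x s)"
        using small eventually_gt_at_top[of 0] eventually_gt_at_top[of x]
        by eventually_elim (simp only: ereal_less_eq, blast intro: order.trans[OF le low])
    qed
  }
qed

end
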